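(* Let $\mathcal{F}$ be a uniformly bounded infinite collection of nonempty, compact, path-connected, and ortho-convex subsets of $\mathbb{R}^2$. Then $\mathcal{F}$ contains a sequence $(S_n)_{n\ge 1}$ of pairwise distinct members and there is a nonempty compact ortho-convex set $S\subset\mathbb{R}^2$ such that $d_{\mathcal{H}}(S_n,S)\to 0$ as $n\to\infty$.
   Context: A set in $\mathbb{R}^2$ is ortho-convex if its intersection with every horizontal line and every vertical line is connected (i.e. empty, a point, or a single interval). A collection of sets is uniformly bounded if all its members are contained in one common bounded set. For nonempty compact sets $A,B\subset\mathbb{R}^2$, the Hausdorff distance is $d_{\mathcal{H}}(A,B)=\max\{\sup_{x\in A}d(x,B),\ \sup_{y\in B}d(y,A)\}$, where $d(x,A)=\inf_{a\in A}\|x-a\|$ and $\|\cdot\|$ is the Euclidean norm. *)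

theory Defs
  imports "HOL-Analysis.Analysis"
begin

definition ortho_convex :: "(real ^ 2) set \<Rightarrow> bool" where
  "ortho_convex S \<longleftrightarrow>
     (\<forall>c. connected (S \<inter> {p. p $ 2 = c})) \<and> (\<forall>c. connected (S \<inter> {p. p $ 1 = c}))"

definition uniformly_bounded :: "'a::metric_space set set \<Rightarrow> bool" where
  "uniformly_bounded \<F> \<longleftrightarrow> (\<exists>B. bounded B \<and> (\<forall>A\<in>\<F>. A \<subseteq> B))"

(* Meaningful only for nonempty bounded (in particular nonempty compact) arguments: otherwise
   infdist x {} = 0 and real-valued suprema of empty or unbounded sets are unspecified. *)
definition hausdorff_dist :: "'a::metric_space set \<Rightarrow> 'a set \<Rightarrow> real" where
  "hausdorff_dist A B = max (SUP x\<in>A. infdist x B) (SUP y\<in>B. infdist y A)"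

end

theory Submission
  imports Defs "HOL-Complex_Analysis.Great_Picard"
begin

text \<open>
  The proof combines a compactness argument, which produces a limit set, with a planar argument,
  which shows that the limit is ortho-convex.

  Compactness is Blaschke's selection theorem (\<open>Blaschke_selection\<close>).  The distance functions
  \<open>\<lambda>x. infdist x A\<close> of the subsets \<open>A\<close> of a compact set are equibounded and 1-Lipschitz, so by
  Arzela--Ascoli any sequence of them has a uniformly convergent subsequence; the zero set of the
  limit function is the Hausdorff limit of the corresponding sets.  An infinite family contains an
  injective sequence, and every subsequence of it is still injective.

  Hausdorff limits of ortho-convex sets need not be ortho-convex in general (two-point sets may
  converge to a two-point set on a horizontal line), so connectedness has to enter.  Suppose a
  connected ortho-convex set \<open>A\<close> has points \<open>p\<close> and \<open>q\<close> almost level with a point \<open>z\<close>, one on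
  either side of it.  Then \<open>A\<close> meets the line through \<open>z\<close> perpendicular to that level.  If it
  did so only far away from \<open>z\<close>, it would, its sections being connected, do so on one side only;
  so \<open>A\<close> would pass from \<open>p\<close> to \<open>q\<close> by a detour around \<open>z\<close>, and some line nearly level with \<open>z\<close>
  would meet \<open>A\<close> on both sides of the perpendicular but not on it, against ortho-convexity
  (\<open>ortho_convex_meets_perpendicular_nearby\<close>).  Hence \<open>A\<close> has a point near \<open>z\<close>;
  letting \<open>A\<close> run through sets converging to \<open>S\<close>, every point between two points of \<open>S\<close> on a
  horizontal or vertical line lies in \<open>S\<close> (\<open>ortho_convex_Hausdorff_limit\<close>).
\<close>

section \<open>Hausdorff distance and pointwise approximation\<close>

lemma hausdorff_dist_bounds:
  assumes "A \<noteq> {}" "B \<noteq> {}"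
    and A: "\<And>x. x \<in> A \<Longrightarrow> infdist x B \<le> e"
    and B: "\<And>y. y \<in> B \<Longrightarrow> infdist y A \<le> e"
  shows "0 \<le> hausdorff_dist A B" and "hausdorff_dist A B \<le> e"
proof -
  obtain x where "x \<in> A" using \<open>A \<noteq> {}\<close> by auto
  have "bdd_above ((\<lambda>x. infdist x B) ` A)"
    using A by (auto intro!: bdd_aboveI2)
  then have "infdist x B \<le> (SUP x\<in>A. infdist x B)"
    using \<open>x \<in> A\<close> by (rule cSUP_upper[rotated])
  then show "0 \<le> hausdorff_dist A B"
    using infdist_nonneg[of x B] unfolding hausdorff_dist_def by linarith
  show "hausdorff_dist A B \<le> e"
    unfolding hausdorff_dist_def using assms by (auto intro!: cSUP_least)
qed

lemma bounded_imp_bdd_above_infdist: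
  fixes A B :: "'a::metric_space set"
  assumes "bounded A" "B \<noteq> {}"
  shows "bdd_above ((\<lambda>x. infdist x B) ` A)"
proof -
  obtain b where "b \<in> B" using \<open>B \<noteq> {}\<close> by auto
  obtain M where M: "\<forall>x\<in>A. dist b x \<le> M"
    using \<open>bounded A\<close> bounded_any_center by blast
  show ?thesis
    by (rule bdd_aboveI2[of _ _ M]) (use M \<open>b \<in> B\<close> in \<open>auto simp: dist_commute intro: infdist_le2\<close>)
qed

lemma hausdorff_dist_less_imp_near:
  fixes A B :: "'a::heine_borel set"
  assumes "compact A" "compact B" "A \<noteq> {}" "B \<noteq> {}" and less: "hausdorff_dist A B < e"
  shows "x \<in> A \<Longrightarrow> \<exists>y\<in>B. dist x y < e" and "y \<in> B \<Longrightarrow> \<exists>x\<in>A. dist y x < e"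
proof -
  have sup: "(SUP x\<in>A. infdist x B) < e" "(SUP y\<in>B. infdist y A) < e"
    using less by (auto simp: hausdorff_dist_def)
  show "\<exists>y\<in>B. dist x y < e" if "x \<in> A"
  proof -
    have "infdist x B \<le> (SUP x\<in>A. infdist x B)"
      using assms that by (intro cSUP_upper bounded_imp_bdd_above_infdist compact_imp_bounded)
    then show ?thesis
      using infdist_attains_inf[of B x] assms sup(1) by (metis compact_imp_closed order_le_less_trans)
  qed
  show "\<exists>x\<in>A. dist y x < e" if "y \<in> B"
  proof -
    have "infdist y A \<le> (SUP y\<in>B. infdist y A)"
      using assms that by (intro cSUP_upper bounded_imp_bdd_above_infdist compact_imp_bounded)
    then show ?thesis
      using infdist_attains_inf[of A y] assms sup(2) by (metis compact_imp_closed order_le_less_trans)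
  qed
qed

section \<open>Blaschke selection\<close>

text \<open>
  With \<open>g\<close> the uniform limit of the distance functions of \<open>X (k n)\<close> and \<open>S\<close> its zero set, one half
  of the Hausdorff distance is immediate, since \<open>infdist y (X (k n))\<close> tends to \<open>g y = 0\<close>
  uniformly over \<open>y\<close> in \<open>S\<close>.  For the other half it suffices that \<open>infdist x S \<le> g x\<close>: an
  accumulation point \<open>a\<close> of the points of \<open>X (k n)\<close> nearest to \<open>x\<close> satisfies \<open>g a = 0\<close> and
  \<open>dist x a = g x\<close>.  The existence of \<open>a\<close> also shows that \<open>S\<close> is nonempty.
\<close>
theorem Blaschke_selection:
  fixes X :: "nat \<Rightarrow> 'a::euclidean_space set"
  assumes K: "compact K"
    and X: "\<And>n. compact (X n)" "\<And>n. X n \<noteq> {}" "\<And>n. X n \<subseteq> K"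
  obtains k S where "strict_mono (k :: nat \<Rightarrow> nat)" "compact S" "S \<noteq> {}"
    "(\<lambda>n. hausdorff_dist (X (k n)) S) \<longlonglongrightarrow> 0"
proof -
  have bound: "norm (infdist x (X n)) \<le> diameter K" if "x \<in> K" for n x
  proof -
    obtain a where "a \<in> X n" using X(2) by blast
    then have "dist x a \<le> diameter K"
      using X(3) that K by (auto intro: diameter_bounded_bound compact_imp_bounded)
    then show ?thesis
      using \<open>a \<in> X n\<close> by (simp add: infdist_nonneg infdist_le2)
  qed
  have equicont: "\<exists>d>0. \<forall>n y. y \<in> K \<and> norm (x - y) < d \<longrightarrow>
      norm (infdist x (X n) - infdist y (X n)) < e" if "0 < e" for x e
  proof (intro exI[of _ e] conjI allI impI)
    fix n y assume "y \<in> K \<and> norm (x - y) < e"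
    then show "norm (infdist x (X n) - infdist y (X n)) < e"
      using infdist_triangle_abs[of x "X n" y] by (simp add: dist_norm)
  qed (fact that)
  obtain g and k :: "nat \<Rightarrow> nat" where g: "continuous_on K g" and k: "strict_mono k"
    and unif: "\<And>e. 0 < e \<Longrightarrow>
      \<exists>N. \<forall>n x. n \<ge> N \<and> x \<in> K \<longrightarrow> norm (infdist x (X (k n)) - g x) < e"
    using Arzela_Ascoli[where S = K and \<F> = "\<lambda>n x. infdist x (X n)", OF K bound equicont] by blast
  define S where "S = {x \<in> K. g x = 0}"
  have "closed S"
    unfolding S_def using continuous_closed_preimage_constant[OF g] K compact_imp_closed by blast
  then have "compact S"
    using K compact_Int_closed[of K S] by (simp add: S_def Int_absorb1 inf.absorb2)
  have lim: "(\<lambda>n. infdist x (X (k n))) \<longlonglongrightarrow> g x" if "x \<in> K" for x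
    unfolding lim_sequentially dist_norm using unif that by blast
  have near: "\<exists>a\<in>S. dist x a = g x" if "x \<in> K" for x
  proof -
    have "\<exists>a. a \<in> X (k n) \<and> infdist x (X (k n)) = dist x a" for n
      using infdist_attains_inf[OF compact_imp_closed[OF X(1)] X(2)] by blast
    then obtain a where a: "\<And>n. a n \<in> X (k n)" "\<And>n. infdist x (X (k n)) = dist x (a n)"
      by metis
    obtain b r where b: "b \<in> K" "strict_mono r" "(a \<circ> r) \<longlonglongrightarrow> b"
      using K[unfolded compact_def, rule_format, of a] a(1) X(3) by blast
    have "(\<lambda>n. dist x (a (r n))) \<longlonglongrightarrow> g x"
      using LIMSEQ_subseq_LIMSEQ[OF lim[OF that] b(2)] by (simp add: a(2) o_def)
    moreover have "(\<lambda>n. dist x (a (r n))) \<longlonglongrightarrow> dist x b"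
      using b(3) by (intro tendsto_intros) (simp add: o_def)
    ultimately have "dist x b = g x"
      using LIMSEQ_unique by blast
    moreover have "g b = 0"
    proof (rule LIMSEQ_unique)
      show "(\<lambda>n. infdist b (X (k (r n)))) \<longlonglongrightarrow> g b"
        using LIMSEQ_subseq_LIMSEQ[OF lim[OF b(1)] b(2)] by (simp add: o_def)
      have "(\<lambda>n. dist b (a (r n))) \<longlonglongrightarrow> 0"
        using b(3)[THEN tendsto_dist_iff[THEN iffD1]] by (simp add: o_def dist_commute)
      then show "(\<lambda>n. infdist b (X (k (r n)))) \<longlonglongrightarrow> 0"
        by (rule Lim_null_comparison[rotated]) (simp add: infdist_nonneg infdist_le a(1))
    qed
    ultimately show ?thesis
      using b(1) S_def by blast
  qed
  have "S \<noteq> {}"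
    using near X(2)[of 0] X(3)[of 0] by blast
  have "(\<lambda>n. hausdorff_dist (X (k n)) S) \<longlonglongrightarrow> 0"
  proof (rule LIMSEQ_I)
    fix e :: real assume "0 < e"
    then obtain N where
      N: "\<And>n x. n \<ge> N \<Longrightarrow> x \<in> K \<Longrightarrow> norm (infdist x (X (k n)) - g x) < e / 2"
      using unif[of "e / 2"] by auto
    have "norm (hausdorff_dist (X (k n)) S - 0) < e" if "n \<ge> N" for n
    proof -
      have "infdist x S \<le> e / 2" if "x \<in> X (k n)" for x
      proof -
        have "x \<in> K" using that X(3) by blast
        then obtain s where "s \<in> S" "dist x s = g x" using near by blast
        then have "infdist x S \<le> g x" using infdist_le[of s S x] by simp
        then show ?thesis using N[OF \<open>n \<ge> N\<close> \<open>x \<in> K\<close>] that by simp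
      qed
      moreover have "infdist y (X (k n)) \<le> e / 2" if "y \<in> S" for y
        using N[OF \<open>n \<ge> N\<close>, of y] that by (auto simp: S_def)
      ultimately show ?thesis
        using hausdorff_dist_bounds[OF X(2) \<open>S \<noteq> {}\<close>, of "k n" "e / 2"] \<open>0 < e\<close> by auto
    qed
    then show "\<exists>N. \<forall>n\<ge>N. norm (hausdorff_dist (X (k n)) S - 0) < e" by blast
  qed
  with k \<open>compact S\<close> \<open>S \<noteq> {}\<close> that show thesis by blast
qed

section \<open>Ortho-convexity as betweenness\<close>

lemma ortho_convex_iff_connected_slices:
  "ortho_convex S \<longleftrightarrow> (\<forall>j c. connected (S \<inter> {p. p $ j = c}))"
  unfolding ortho_convex_def by (auto simp: forall_2)

lemma vec2_eqI:
  fixes x y :: "'a ^ 2"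
  assumes "i \<noteq> j" "x $ i = y $ i" "x $ j = y $ j"
  shows "x = y"
proof -
  have "k = i \<or> k = j" for k :: 2
    using \<open>i \<noteq> j\<close> exhaust_2[of i] exhaust_2[of j] exhaust_2[of k] by auto
  then have "x $ k = y $ k" for k
    using assms(2,3) by metis
  then show ?thesis
    by (simp add: vec_eq_iff)
qed

lemma connected_slice_between:
  fixes A :: "(real ^ 2) set"
  assumes "connected (A \<inter> {p. p $ j = c})"
    and "p \<in> A" "p $ j = c" "q \<in> A" "q $ j = c" "p $ i \<le> a" "a \<le> q $ i"
  shows "\<exists>w\<in>A. w $ i = a \<and> w $ j = c"
  using connected_ivt_component_cart[of "A \<inter> {p. p $ j = c}" p q i a] assms by auto

text \<open>The index pair \<open>i \<noteq> j\<close> treats horizontal and vertical lines alike: \<open>j\<close> is the coordinate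
  that is constant on the line and \<open>i\<close> the one that varies.\<close>
lemma ortho_convexI:
  fixes S :: "(real ^ 2) set"
  assumes between: "\<And>i j p q z. \<lbrakk>i \<noteq> j; p \<in> S; q \<in> S; p $ j = z $ j; q $ j = z $ j;
      p $ i < z $ i; z $ i < q $ i\<rbrakk> \<Longrightarrow> z \<in> S"
  shows "ortho_convex S"
  unfolding ortho_convex_iff_connected_slices
proof (intro allI)
  fix j :: 2 and c :: real
  obtain i :: 2 where "i \<noteq> j"
    by (metis (full_types) zero_neq_one)
  have ordered: "z \<in> S" if pq: "p \<in> S" "q \<in> S" "p $ j = z $ j" "q $ j = z $ j"
    and le: "p $ i \<le> z $ i" "z $ i \<le> q $ i" for p q z
  proof (cases "p $ i = z $ i \<or> q $ i = z $ i")
    case True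
    then have "p = z \<or> q = z"
      using vec2_eqI[OF \<open>i \<noteq> j\<close>] pq(3,4) by blast
    then show ?thesis using pq by blast
  next
    case False
    then show ?thesis
      using between[OF \<open>i \<noteq> j\<close> pq] le by linarith
  qed
  have "convex (S \<inter> {p. p $ j = c})"
    unfolding convex_contains_segment
  proof (intro ballI subsetI)
    fix p q z assume p: "p \<in> S \<inter> {p. p $ j = c}" and q: "q \<in> S \<inter> {p. p $ j = c}"
      and "z \<in> closed_segment p q"
    then obtain u where u: "0 \<le> u" "u \<le> 1" "z = (1 - u) *\<^sub>R p + u *\<^sub>R q"
      by (auto simp: in_segment)
    have zj: "z $ j = c"
      using p q unfolding u(3) by (simp add: left_diff_distrib)
    have "z $ i \<in> closed_segment (p $ i) (q $ i)"
      using u(1,2) unfolding in_segment u(3) by auto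
    then have "p $ i \<le> z $ i \<and> z $ i \<le> q $ i \<or> q $ i \<le> z $ i \<and> z $ i \<le> p $ i"
      unfolding closed_segment_eq_real_ivl by (simp split: if_splits)
    then show "z \<in> S \<inter> {p. p $ j = c}"
      using ordered[of p q z] ordered[of q p z] p q zj by auto
  qed
  then show "connected (S \<inter> {p. p $ j = c})"
    by (rule convex_connected)
qed

section \<open>A connected set cannot avoid a neighbourhood by a detour\<close>

lemma connected_meets_quadrant_boundary:
  fixes f g :: "'a::topological_space \<Rightarrow> real"
  assumes "continuous_on UNIV f" "continuous_on UNIV g" "connected A"
    and "p \<in> A" "0 \<le> f p" "0 \<le> g p" and "q \<in> A" "\<not> (0 \<le> f q \<and> 0 \<le> g q)"
  shows "\<exists>x\<in>A. f x = 0 \<and> 0 \<le> g x \<or> g x = 0 \<and> 0 \<le> f x"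
proof -
  define Q where "Q = {x. 0 \<le> f x \<and> 0 \<le> g x}"
  define U where "U = {x. 0 < f x \<and> 0 < g x}"
  have "closed Q"
    unfolding Q_def using assms by (intro closed_Collect_conj closed_Collect_le continuous_intros)
  have "open U"
    unfolding U_def using assms by (intro open_Collect_conj open_Collect_less continuous_intros)
  moreover have "U \<subseteq> Q"
    by (auto simp: U_def Q_def)
  ultimately have "frontier Q \<subseteq> Q - U"
    using \<open>closed Q\<close> by (auto simp: frontier_def interior_maximal dest: interior_maximal)
  moreover have "A \<inter> frontier Q \<noteq> {}"
    using assms by (intro connected_Int_frontier) (auto simp: Q_def)
  ultimately obtain x where "x \<in> A" "x \<in> Q" "x \<notin> U" by blast
  then show ?thesis
    by (intro bexI[of _ x]) (auto simp: Q_def U_def)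
qed

text \<open>
  Think of \<open>f\<close> as the horizontal and \<open>g\<close> as the vertical coordinate.  If \<open>A\<close> crosses the
  line \<open>f = 0\<close> only strictly above level 0, then it cannot leave the quadrants \<open>f \<le> 0, g \<le> 0\<close> and
  \<open>f \<ge> 0, g \<le> 0\<close> through their vertical sides, and must leave each through its top side.
\<close>
lemma connected_detour_climbs_on_both_sides:
  fixes f g :: "'a::topological_space \<Rightarrow> real"
  assumes cont: "continuous_on UNIV f" "continuous_on UNIV g" and "connected A"
    and p: "p \<in> A" "f p < 0" "g p \<le> 0" and q: "q \<in> A" "0 < f q" "g q \<le> 0"
    and above: "\<And>x. x \<in> A \<Longrightarrow> f x = 0 \<Longrightarrow> 0 < g x"
  shows "\<exists>x\<in>A. g x = 0 \<and> f x \<le> 0" and "\<exists>y\<in>A. g y = 0 \<and> 0 \<le> f y"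
proof -
  have "\<exists>x\<in>A. (- f x) = 0 \<and> 0 \<le> (- g x) \<or> (- g x) = 0 \<and> 0 \<le> (- f x)"
    using cont \<open>connected A\<close> p q
    by (intro connected_meets_quadrant_boundary[of _ _ A p q]) (auto intro!: continuous_intros)
  then show "\<exists>x\<in>A. g x = 0 \<and> f x \<le> 0"
    using above by fastforce
  have "\<exists>x\<in>A. f x = 0 \<and> 0 \<le> (- g x) \<or> (- g x) = 0 \<and> 0 \<le> f x"
    using cont \<open>connected A\<close> p q
    by (intro connected_meets_quadrant_boundary[of _ _ A q p]) (auto intro!: continuous_intros)
  then show "\<exists>y\<in>A. g y = 0 \<and> 0 \<le> f y"
    using above by fastforce
qed

text \<open>
  Otherwise the section of \<open>A\<close> by the perpendicular \<open>w $ i = z $ i\<close>, being connected, lies entirely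
  on one side of \<open>z\<close>, at distance at least \<open>r\<close>.  The line \<open>w $ j = h\<close> through whichever of \<open>p\<close>
  and \<open>q\<close> is farther towards that side still passes within \<open>r\<close> of \<open>z\<close>.  By the preceding lemma it
  meets \<open>A\<close> on both sides of the perpendicular, hence on it.
\<close>
lemma ortho_convex_meets_perpendicular_nearby:
  fixes A :: "(real ^ 2) set"
  assumes A: "connected A" "ortho_convex A"
    and p: "p \<in> A" "p $ i < z $ i" "\<bar>p $ j - z $ j\<bar> < r"
    and q: "q \<in> A" "z $ i < q $ i" "\<bar>q $ j - z $ j\<bar> < r"
  shows "\<exists>w\<in>A. w $ i = z $ i \<and> \<bar>w $ j - z $ j\<bar> < r"
proof (rule ccontr)
  assume "\<not> ?thesis"
  then have far: "r \<le> \<bar>w $ j - z $ j\<bar>" if "w \<in> A" "w $ i = z $ i" for w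
    using that by fastforce
  have slices: "connected (A \<inter> {x. x $ l = c})" for l c
    using A(2) by (simp add: ortho_convex_iff_connected_slices)
  have no_level: False
    if "x \<in> A" "y \<in> A" "x $ j = h" "y $ j = h" "x $ i \<le> z $ i" "z $ i \<le> y $ i" "\<bar>h - z $ j\<bar> < r"
    for x y h
    using connected_slice_between[OF slices, of x j h y i "z $ i"] far that by fastforce
  consider (above) "\<And>w. w \<in> A \<Longrightarrow> w $ i = z $ i \<Longrightarrow> z $ j + r \<le> w $ j"
    | (below) "\<And>w. w \<in> A \<Longrightarrow> w $ i = z $ i \<Longrightarrow> w $ j \<le> z $ j - r"
  proof -
    have False if "v \<in> A" "v $ i = z $ i" "v $ j < z $ j" "w \<in> A" "w $ i = z $ i" "z $ j < w $ j" for v w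
      using connected_slice_between[OF slices, of v i "z $ i" w j "z $ j"] far that p(3) by force
    then have "(\<forall>w\<in>A. w $ i = z $ i \<longrightarrow> z $ j \<le> w $ j) \<or> (\<forall>w\<in>A. w $ i = z $ i \<longrightarrow> w $ j \<le> z $ j)"
      by (meson linorder_not_le)
    then show thesis
    proof
      assume "\<forall>w\<in>A. w $ i = z $ i \<longrightarrow> z $ j \<le> w $ j"
      then show thesis using far by (intro above) fastforce
    next
      assume "\<forall>w\<in>A. w $ i = z $ i \<longrightarrow> w $ j \<le> z $ j"
      then show thesis using far by (intro below) fastforce
    qed
  qed
  then show False
  proof cases
    case above
    define h where "h = max (p $ j) (q $ j)"
    have h: "\<bar>h - z $ j\<bar> < r" "p $ j \<le> h" "q $ j \<le> h"
      using p(3) q(3) by (auto simp: h_def)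
    let ?f = "\<lambda>x. x $ i - z $ i" and ?g = "\<lambda>x. x $ j - h"
    have cont: "continuous_on UNIV ?f" "continuous_on UNIV ?g"
      by (intro continuous_intros)+
    have pos: "0 < ?g x" if "x \<in> A" "?f x = 0" for x
      using above[of x] that h(1) by (simp add: abs_less_iff)
    have ends: "?f p < 0" "?g p \<le> 0" "0 < ?f q" "?g q \<le> 0"
      using p q h by auto
    note climbs = connected_detour_climbs_on_both_sides[OF cont A(1) p(1) ends(1,2) q(1) ends(3,4)]
    have "\<exists>x\<in>A. ?g x = 0 \<and> ?f x \<le> 0" "\<exists>y\<in>A. ?g y = 0 \<and> 0 \<le> ?f y"
      by (rule climbs, fact pos)+
    then obtain x y where "x \<in> A" "?g x = 0" "?f x \<le> 0" "y \<in> A" "?g y = 0" "0 \<le> ?f y"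
      by blast
    then show False
      by (intro no_level[of x y h] h(1)) linarith+
  next
    case below
    define h where "h = min (p $ j) (q $ j)"
    have h: "\<bar>h - z $ j\<bar> < r" "h \<le> p $ j" "h \<le> q $ j"
      using p(3) q(3) by (auto simp: h_def)
    let ?f = "\<lambda>x. x $ i - z $ i" and ?g = "\<lambda>x. h - x $ j"
    have cont: "continuous_on UNIV ?f" "continuous_on UNIV ?g"
      by (intro continuous_intros)+
    have pos: "0 < ?g x" if "x \<in> A" "?f x = 0" for x
      using below[of x] that h(1) by (simp add: abs_less_iff)
    have ends: "?f p < 0" "?g p \<le> 0" "0 < ?f q" "?g q \<le> 0"
      using p q h by auto
    note climbs = connected_detour_climbs_on_both_sides[OF cont A(1) p(1) ends(1,2) q(1) ends(3,4)]
    have "\<exists>x\<in>A. ?g x = 0 \<and> ?f x \<le> 0" "\<exists>y\<in>A. ?g y = 0 \<and> 0 \<le> ?f y"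
      by (rule climbs, fact pos)+
    then obtain x y where "x \<in> A" "?g x = 0" "?f x \<le> 0" "y \<in> A" "?g y = 0" "0 \<le> ?f y"
      by blast
    then show False
      by (intro no_level[of x y h] h(1)) linarith+
  qed
qed

section \<open>Hausdorff limits of connected ortho-convex sets\<close>

text \<open>
  Let \<open>z\<close> lie between \<open>p\<close> and \<open>q\<close> on an axis-parallel line.  A set \<open>A\<close> close to \<open>S\<close> has
  points \<open>p'\<close> and \<open>q'\<close> near \<open>p\<close> and \<open>q\<close>, hence a point near \<open>z\<close>, hence so has \<open>S\<close>; and \<open>S\<close> is
  closed.
\<close>
lemma ortho_convex_Hausdorff_limit:
  fixes S :: "(real ^ 2) set"
  assumes S: "compact S" "S \<noteq> {}"
    and approx: "\<And>e. 0 < e \<Longrightarrow> \<exists>A. A \<noteq> {} \<and> compact A \<and> connected A \<and> ortho_convex A \<and>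
      hausdorff_dist A S < e"
  shows "ortho_convex S"
proof (rule ortho_convexI)
  fix i j :: 2 and p q z :: "real ^ 2"
  assume "i \<noteq> j" and pq: "p \<in> S" "q \<in> S" "p $ j = z $ j" "q $ j = z $ j"
    and between: "p $ i < z $ i" "z $ i < q $ i"
  have "\<exists>y\<in>S. dist y z < e" if "0 < e" for e
  proof -
    \<comment> \<open>Small enough that approximants of \<open>p\<close> and \<open>q\<close> stay on their own sides of \<open>z\<close>.\<close>
    define r where "r = min (e / 2) (min (z $ i - p $ i) (q $ i - z $ i))"
    have r: "0 < r" "r \<le> e / 2" "r \<le> z $ i - p $ i" "r \<le> q $ i - z $ i"
      unfolding r_def using that between by linarith+
    obtain A where A: "A \<noteq> {}" "compact A" "connected A" "ortho_convex A" "hausdorff_dist A S < r"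
      using approx[OF r(1)] by blast
    note near = hausdorff_dist_less_imp_near[OF A(2) S(1) A(1) S(2) A(5)]
    obtain p' where p': "p' \<in> A" "dist p p' < r"
      using near(2) pq(1) by blast
    obtain q' where q': "q' \<in> A" "dist q q' < r"
      using near(2) pq(2) by blast
    have coord: "\<bar>x $ l - y $ l\<bar> \<le> dist x y" for x y :: "real ^ 2" and l
      using dist_vec_nth_le[of x l y] by (simp add: dist_real_def)
    have "\<exists>w\<in>A. w $ i = z $ i \<and> \<bar>w $ j - z $ j\<bar> < r"
    proof (rule ortho_convex_meets_perpendicular_nearby[OF A(3,4) p'(1) _ _ q'(1)])
      show "p' $ i < z $ i" "\<bar>p' $ j - z $ j\<bar> < r"
        using coord[of p i p'] coord[of p j p'] p'(2) r pq by linarith+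
      show "z $ i < q' $ i" "\<bar>q' $ j - z $ j\<bar> < r"
        using coord[of q i q'] coord[of q j q'] q'(2) r pq by linarith+
    qed
    then obtain w where w: "w \<in> A" "w $ i = z $ i" "\<bar>w $ j - z $ j\<bar> < r" by blast
    have "dist w z < r"
    proof -
      have "w - z = axis j (w $ j - z $ j)"
        using w(2) \<open>i \<noteq> j\<close> by (intro vec2_eqI[OF \<open>i \<noteq> j\<close>]) (auto simp: axis_def)
      then show ?thesis
        using w(3) by (simp add: dist_norm norm_eq_sqrt_inner inner_axis_axis)
    qed
    moreover obtain y where "y \<in> S" "dist w y < r"
      using near(1) w(1) by blast
    ultimately have "dist y z < e"
      using dist_triangle[of y z w] r(2) by (simp add: dist_commute)
    with \<open>y \<in> S\<close> show ?thesis by blast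
  qed
  then show "z \<in> S"
    using closed_approachable compact_imp_closed S(1) by blast
qed

theorem theorem1:
  fixes \<F> :: "(real ^ 2) set set"
  assumes "infinite \<F>"
    and "uniformly_bounded \<F>"
    and "\<And>A. A \<in> \<F> \<Longrightarrow> A \<noteq> {} \<and> compact A \<and> path_connected A \<and> ortho_convex A"
  shows "\<exists>(X :: nat \<Rightarrow> (real ^ 2) set) S.
           range X \<subseteq> \<F> \<and> inj X \<and>
           S \<noteq> {} \<and> compact S \<and> ortho_convex S \<and>
           (\<lambda>n. hausdorff_dist (X n) S) \<longlonglongrightarrow> 0"
proof -
  obtain Y :: "nat \<Rightarrow> (real ^ 2) set" where Y: "inj Y" "range Y \<subseteq> \<F>"
    using infinite_countable_subset[OF \<open>infinite \<F>\<close>] by blast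
  obtain B where B: "bounded B" "\<And>A. A \<in> \<F> \<Longrightarrow> A \<subseteq> B"
    using assms(2) by (auto simp: uniformly_bounded_def)
  have "compact (closure B)"
    using B(1) by simp
  moreover have "compact (Y n)" "Y n \<noteq> {}" "Y n \<subseteq> closure B" for n
    using assms(3)[of "Y n"] B(2)[of "Y n"] Y(2) closure_subset[of B] by auto
  ultimately obtain k S where k: "strict_mono (k :: nat \<Rightarrow> nat)" and S: "compact S" "S \<noteq> {}"
    and lim: "(\<lambda>n. hausdorff_dist (Y (k n)) S) \<longlonglongrightarrow> 0"
    by (rule Blaschke_selection)
  have "ortho_convex S"
  proof (rule ortho_convex_Hausdorff_limit[OF S])
    fix e :: real assume "0 < e"
    then obtain n where "hausdorff_dist (Y (k n)) S < e"
      using order_tendstoD(2)[OF lim] by (auto simp: eventually_sequentially)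
    then show "\<exists>A. A \<noteq> {} \<and> compact A \<and> connected A \<and> ortho_convex A \<and> hausdorff_dist A S < e"
      using assms(3)[of "Y (k n)"] Y(2) path_connected_imp_connected by blast
  qed
  moreover have "inj (\<lambda>n. Y (k n))"
    using Y(1) k by (metis injD inj_onI strict_mono_eq)
  moreover have "range (\<lambda>n. Y (k n)) \<subseteq> \<F>"
    using Y(2) by auto
  ultimately show ?thesis
    using S lim by blast
qed

end
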